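(* For every (fixed, finite) graph $H$ with at least $6$ edges, there is a constant $b=b(H)>0$ such that $C(n,H)=\Omega(n^{b})$ as $n\to\infty$.
   Context: For a graph $H$ and a positive integer $n$, $C(n,H)$ denotes the minimum integer $k$ such that there exist $n$ colorings $f_v:E(K_n)\to[k]$, one for each vertex $v\in V(K_n)$ (the colorings need not be proper), with the following property: for every copy $T$ of $H$ in $K_n$, there is a vertex $v\in V(T)$ such that $f_v$ assigns pairwise distinct colors to all edges of $E(T)$. *)

theory Defs
  imports Complex_Main "HOL-Library.FuncSet" "HOL-Library.Landau_Symbols"
begin

text \<open>Graphs are pairs of a vertex set and a set of two-element edges.\<close>

definition complete_edges :: "'a set \<Rightarrow> 'a set set" where
  "complete_edges V = {e. e \<subseteq> V \<and> card e = 2}"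

definition finite_simple_graph :: "'a set \<Rightarrow> 'a set set \<Rightarrow> bool" where
  "finite_simple_graph V E \<longleftrightarrow> finite V \<and> E \<subseteq> complete_edges V"

definition graph_isomorphic :: "'a set \<Rightarrow> 'a set set \<Rightarrow> 'b set \<Rightarrow> 'b set set \<Rightarrow> bool" where
  "graph_isomorphic V E W F \<longleftrightarrow> (\<exists>\<phi>. bij_betw \<phi> V W \<and> (\<lambda>e. \<phi> ` e) ` E = F)"

text \<open>The complete graph on \<open>n\<close> vertices has vertex set \<open>{..<n}\<close>. A copy of \<open>(V, E)\<close> in it is a
  subgraph \<open>(W, F)\<close>, not necessarily induced, that is isomorphic to \<open>(V, E)\<close>; isolated vertices
  of \<open>(V, E)\<close> are represented in \<open>W\<close>.\<close>

definition copy_in_complete :: "nat \<Rightarrow> 'a set \<Rightarrow> 'a set set \<Rightarrow> nat set \<Rightarrow> nat set set \<Rightarrow> bool" where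
  "copy_in_complete n V E W F \<longleftrightarrow>
     W \<subseteq> {..<n} \<and> F \<subseteq> complete_edges W \<and> graph_isomorphic V E W F"

definition local_rainbow :: "nat \<Rightarrow> 'a set \<Rightarrow> 'a set set \<Rightarrow> nat \<Rightarrow> (nat \<Rightarrow> nat set \<Rightarrow> nat) \<Rightarrow> bool" where
  "local_rainbow n V E k f \<longleftrightarrow>
     (\<forall>v<n. f v \<in> complete_edges {..<n} \<rightarrow> {1..k}) \<and>
     (\<forall>W F. copy_in_complete n V E W F \<longrightarrow> (\<exists>v\<in>W. inj_on (f v) F))"

definition local_rainbow_number :: "nat \<Rightarrow> 'a set \<Rightarrow> 'a set set \<Rightarrow> nat" where
  "local_rainbow_number n V E = (LEAST k. \<exists>f. local_rainbow n V E k f)"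

text \<open>The minimum is attained as soon as the graph has a vertex: colour all edges differently.\<close>

lemma local_rainbow_number_attained:
  assumes "V \<noteq> {}"
  shows "\<exists>f. local_rainbow n V E (local_rainbow_number n V E) f"
proof -
  let ?K = "complete_edges {..<n}"
  have "finite ?K"
    by (rule finite_subset[of _ "Pow {..<n}"]) (auto simp: complete_edges_def)
  then obtain h where h: "bij_betw h ?K {1..card ?K}"
    using ex_bij_betw_finite_nat[of ?K] bij_betw_iff_card[of ?K "{1..card ?K}"] by auto
  have "local_rainbow n V E (card ?K) (\<lambda>_. h)"
    unfolding local_rainbow_def
  proof (intro conjI allI impI)
    show "h \<in> ?K \<rightarrow> {1..card ?K}"
      using h by (auto simp: bij_betw_def)
  next
    fix W F assume c: "copy_in_complete n V E W F"
    then have "W \<noteq> {}"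
      using assms by (auto simp: copy_in_complete_def graph_isomorphic_def bij_betw_def)
    moreover have "F \<subseteq> ?K"
      using c by (auto simp: copy_in_complete_def complete_edges_def)
    then have "inj_on h F"
      using h by (auto simp: bij_betw_def intro: inj_on_subset)
    ultimately show "\<exists>v\<in>W. inj_on h F" by blast
  qed
  then have "\<exists>f. local_rainbow n V E (card ?K) f" by blast
  then show ?thesis
    unfolding local_rainbow_number_def by (rule LeastI)
qed

end

theory Submission imports Defs begin

text \<open>
  A graph with at least six edges contains a cherry \<open>y\<^sub>1 - x - y\<^sub>2\<close> together with two edges avoiding
  \<open>y\<^sub>1\<close> and \<open>y\<^sub>2\<close>, or four disjoint edges, or a four-cycle. In each case a set \<open>Y\<close> of two or four
  vertices is split off such that a coincidence of colours outside \<open>Y\<close> spoils the colourings of the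
  vertices of \<open>Y\<close>, and a coincidence involving \<open>Y\<close> spoils those of all other vertices.
  Suppose that there are \<open>k\<close> colours. Among \<open>k + 1\<close> candidates every vertex sees two of the same
  colour, so the first coincidence can be fixed in such a way that it holds simultaneously for a
  fraction of at least about \<open>1 / (k + 1)\<^sup>2\<close> of all vertices. If more than about \<open>k ^ card V\<close> vertices are left, then
  the pigeonhole principle places \<open>Y\<close> among them so that the second coincidence holds for all the
  remaining vertices at once. Hence \<open>n\<close> is at most polynomial in \<open>k\<close>.
\<close>

section \<open>Graphs with six edges\<close>

lemma edge_doubleton:
  assumes "E \<subseteq> complete_edges V" "d \<in> E"
  obtains a b where "d = {a, b}" "a \<noteq> b" "a \<in> V" "b \<in> V"
  using assms by (auto simp: complete_edges_def card_2_iff)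

lemma edge_other_end:
  assumes "E \<subseteq> complete_edges V" "d \<in> E" "a \<in> d"
  obtains b where "d = {a, b}" "a \<noteq> b" "a \<in> V" "b \<in> V"
  using edge_doubleton[OF assms(1,2)] assms(3) by (metis doubleton_eq_iff insertE singletonD)

lemma finite_complete_edges: "finite V \<Longrightarrow> finite (complete_edges V)"
  by (rule finite_subset[of _ "Pow V"]) (auto simp: complete_edges_def)

lemma ex_not_mem_of_card_less:
  assumes "finite F" "card F < card D"
  obtains d where "d \<in> D" "d \<notin> F"
  using assms by (meson card_mono leD subsetI)

text \<open>If no two edges meet, any four of them form a matching. Otherwise suppose that the first
  outcome fails. Then at most one edge misses both leaves of a given cherry, so at least five of the
  six edges touch a leaf, and one leaf has degree at least three. Two adjacent vertices of degree at
  least three then force a four-cycle.\<close>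

lemma graph_trichotomy:
  assumes G: "finite_simple_graph V E" and card: "card E \<ge> 6"
  obtains
    (cherry) x y z d e where "{x, y} \<in> E" "{x, z} \<in> E" "y \<noteq> z" "d \<in> E" "e \<in> E" "d \<noteq> e"
      "y \<notin> d" "y \<notin> e" "z \<notin> d" "z \<notin> e"
  | (matching) a b c d where "a \<in> E" "b \<in> E" "c \<in> E" "d \<in> E" "a \<inter> b = {}" "a \<inter> c = {}"
      "a \<inter> d = {}" "b \<inter> c = {}" "b \<inter> d = {}" "c \<inter> d = {}"
  | (cycle) x x' y y' where "{x, y} \<in> E" "{x, y'} \<in> E" "{x', y} \<in> E" "{x', y'} \<in> E"
      "x \<noteq> x'" "y \<noteq> y'"
proof -
  have E: "E \<subseteq> complete_edges V" and fin: "finite E"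
    using G finite_complete_edges finite_subset by (auto simp: finite_simple_graph_def)
  define D where "D v = {e \<in> E. v \<in> e}" for v
  have finD: "finite (D v)" for v
    using fin by (simp add: D_def)
  show thesis
  proof (cases "\<exists>x y z. {x, y} \<in> E \<and> {x, z} \<in> E \<and> y \<noteq> z")
    case False
    have disj: "d \<inter> e = {}" if de: "d \<in> E" "e \<in> E" "d \<noteq> e" for d e
    proof (rule ccontr)
      assume "d \<inter> e \<noteq> {}"
      then obtain x where x: "x \<in> d" "x \<in> e" by auto
      obtain y where "d = {x, y}"
        using edge_other_end[OF E de(1) x(1)] .
      moreover obtain z where "e = {x, z}"
        using edge_other_end[OF E de(2) x(2)] .
      ultimately show False
        using False de by blast
    qed
    obtain S where S: "S \<subseteq> E" "card S = 4"
      using card obtain_subset_with_card_n[of 4 E] by auto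
    then obtain a b c d where "S = {a, b, c, d}" "a \<noteq> b" "a \<noteq> c" "a \<noteq> d" "b \<noteq> c" "b \<noteq> d" "c \<noteq> d"
      by (auto simp: card_Suc_eq numeral_eq_Suc)
    then show thesis
      using disj S by (intro matching[of a b c d]) auto
  next
    case True
    then obtain x0 y0 z0 where c0: "{x0, y0} \<in> E" "{x0, z0} \<in> E" "y0 \<noteq> z0" by blast
    show thesis
    proof (rule ccontr)
      assume "\<not> thesis"
      then have avoid: "d = e"
        if "{x, y} \<in> E" "{x, z} \<in> E" "y \<noteq> z" "d \<in> E" "e \<in> E" "y \<notin> d" "y \<notin> e" "z \<notin> d" "z \<notin> e"
        for x y z d e
        using cherry that by blast
      have deg: "card (D y) \<ge> 3 \<or> card (D z) \<ge> 3" if "{x, y} \<in> E" "{x, z} \<in> E" "y \<noteq> z" for x y z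
      proof -
        have "card (E - (D y \<union> D z)) \<le> 1"
          using avoid[OF that] fin by (auto simp: D_def card_le_Suc0_iff_eq)
        moreover have "card E \<le> card (E - (D y \<union> D z)) + card (D y \<union> D z)"
          using card_Un_le[of "E - (D y \<union> D z)" "D y \<union> D z"]
            card_mono[of "E - (D y \<union> D z) \<union> (D y \<union> D z)" E] fin finD by auto
        ultimately show ?thesis
          using card card_Un_le[of "D y" "D z"] by linarith
      qed
      have nbr: "\<exists>b. e = {v, b} \<and> b \<noteq> v" if "e \<in> D v" for e v
        using that edge_doubleton[OF E, of e] by (auto simp: D_def doubleton_eq_iff)
      obtain y where y: "card (D y) \<ge> 3"
        using deg[OF c0] by blast
      obtain e1 where e1: "e1 \<in> D y"
        using ex_not_mem_of_card_less[of "{}" "D y"] y by auto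
      obtain e2 where e2: "e2 \<in> D y" "e2 \<noteq> e1"
        using ex_not_mem_of_card_less[of "{e1}" "D y"] y by auto
      \<comment> \<open>The edges \<open>e1\<close> and \<open>e2\<close> form a cherry centred at
        \<open>y\<close>; by \<open>deg\<close> one of its leaves can serve as
        \<open>w\<close>.\<close>
      obtain w where w: "{y, w} \<in> D y" "w \<noteq> y" "card (D w) \<ge> 3"
      proof -
        obtain p q where pq: "e1 = {y, p}" "p \<noteq> y" "e2 = {y, q}" "q \<noteq> y"
          using nbr[OF e1] nbr[OF e2(1)] by blast
        then have "card (D p) \<ge> 3 \<or> card (D q) \<ge> 3"
          using e1 e2 by (intro deg[of y p q]) (auto simp: D_def)
        then show ?thesis
          using that pq e1 e2 by blast
      qed
      have card_pair: "card {c, d} < 3" for c d :: "'a set"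
        using card_insert_le_m1[of 2 "{d}" c] by simp
      obtain f1 where f1: "f1 \<in> D y" "f1 \<noteq> {y, w}"
        using ex_not_mem_of_card_less[of "{{y, w}}" "D y"] y by auto
      obtain f2 where f2: "f2 \<in> D y" "f2 \<noteq> {y, w}" "f2 \<noteq> f1"
        using ex_not_mem_of_card_less[of "{{y, w}, f1}" "D y"] y card_pair[of "{y, w}" f1] by auto
      obtain u t where ut: "f1 = {y, u}" "u \<noteq> y" "f2 = {y, t}" "t \<noteq> y"
        using nbr[OF f1(1)] nbr[OF f2(1)] by blast
      have neq: "u \<noteq> t" "u \<noteq> w" "t \<noteq> w"
        using f1 f2 ut by auto
      \<comment> \<open>The cherry at \<open>y\<close> with leaves \<open>u\<close> and
        \<open>t\<close> is missed by \<open>{y, w}\<close>, so every other edge at \<open>w\<close>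
        must contain \<open>u\<close> or \<open>t\<close>.\<close>
      have hit: "b = u \<or> b = t" if "{w, b} \<in> E" "b \<noteq> y" for b
      proof (rule ccontr)
        assume "\<not> (b = u \<or> b = t)"
        then have "{w, b} = {y, w}"
          using that w ut f1 f2 neq by (intro avoid[of y u t]) (auto simp: D_def)
        then show False
          using that w by (auto simp: doubleton_eq_iff)
      qed
      obtain g1 where g1: "g1 \<in> D w" "g1 \<noteq> {y, w}"
        using ex_not_mem_of_card_less[of "{{y, w}}" "D w"] w by auto
      obtain g2 where g2: "g2 \<in> D w" "g2 \<noteq> {y, w}" "g2 \<noteq> g1"
        using ex_not_mem_of_card_less[of "{{y, w}, g1}" "D w"] w card_pair[of "{y, w}" g1] by auto
      obtain b1 b2 where b: "g1 = {w, b1}" "g2 = {w, b2}"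
        using nbr[OF g1(1)] nbr[OF g2(1)] by blast
      \<comment> \<open>The two further neighbours of \<open>w\<close> are distinct and lie in
        \<open>{u, t}\<close>, so \<open>w\<close> is adjacent to both, which closes a four-cycle
        through \<open>y\<close>, \<open>u\<close>, \<open>w\<close>, \<open>t\<close>.\<close>
      then have "b1 \<noteq> y" "b2 \<noteq> y" "b1 \<noteq> b2"
        using g1 g2 by (auto simp: insert_commute)
      then have "{w, u} \<in> E" "{w, t} \<in> E"
        using hit[of b1] hit[of b2] b g1 g2 by (auto simp: D_def)
      then show False
        using cycle[of y u t w] \<open>\<not> thesis\<close> ut f1 f2 w neq by (auto simp: D_def)
    qed
  qed
qed

section \<open>Pigeonhole arguments\<close>

text \<open>With \<open>k + 1\<close> candidates and \<open>k\<close> colours every \<open>a\<close>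
  has a colliding pair, so the sets of those \<open>a\<close> for which a given pair collides cover
  \<open>S\<close>. There are at most \<open>(k + 1)\<^sup>2\<close> pairs, and the most popular one
  reaches at least the average.\<close>

lemma popular_pair:
  fixes c :: "'a \<Rightarrow> nat \<Rightarrow> nat"
  assumes "finite S" "S \<noteq> {}" and c: "\<And>a i. a \<in> S \<Longrightarrow> i \<le> k \<Longrightarrow> c a i \<in> {1..k}"
  obtains i j where "i < j" "j \<le> k" "card S \<le> (k + 1)\<^sup>2 * card {a \<in> S. c a i = c a j}"
proof -
  define A where "A = (\<lambda>(i, j). {a \<in> S. c a i = c a j})"
  define P where "P = {(i, j). i < j \<and> j \<le> k}"
  have P: "P \<subseteq> {..k} \<times> {..k}" by (auto simp: P_def)
  then have finP: "finite P" by (rule finite_subset) simp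
  have cardP: "card P \<le> (k + 1)\<^sup>2"
    using card_mono[OF _ P] by (simp add: power2_eq_square)
  have "S \<subseteq> (\<Union>p\<in>P. A p)"
  proof
    fix a assume a: "a \<in> S"
    have "\<not> inj_on (c a) {..k}"
      using c[OF a] card_inj_on_le[of "c a" "{..k}" "{1..k}"] by fastforce
    then obtain i j where "i \<le> k" "j \<le> k" "i \<noteq> j" "c a i = c a j"
      by (auto simp: inj_on_def)
    then have "a \<in> A (min i j, max i j)" "(min i j, max i j) \<in> P"
      using a by (auto simp: A_def P_def min_def max_def)
    then show "a \<in> (\<Union>p\<in>P. A p)" by blast
  qed
  then have cardS: "card S \<le> (\<Sum>p\<in>P. card (A p))"
    using finP assms(1)
    by (intro order_trans[OF card_mono card_UN_le]) (auto simp: A_def)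
  have "P \<noteq> {}"
    using \<open>S \<subseteq> _\<close> \<open>S \<noteq> {}\<close> by auto
  define M where "M = Max ((\<lambda>p. card (A p)) ` P)"
  have "M \<in> (\<lambda>p. card (A p)) ` P"
    unfolding M_def using \<open>P \<noteq> {}\<close> finP by (intro Max_in) auto
  then obtain i j where ij: "(i, j) \<in> P" "M = card (A (i, j))" by auto
  have "card S \<le> card P * M"
    using cardS sum_bounded_above[of P "\<lambda>p. card (A p)" M] finP by (simp add: M_def)
  also have "\<dots> \<le> (k + 1)\<^sup>2 * M"
    using cardP by (rule mult_le_mono1)
  finally show thesis
    using that ij by (auto simp: P_def A_def)
qed

text \<open>The colours seen by all \<open>v\<close> together form a vector with only
  \<open>k ^ card V\<close> possible values, so two indices share the whole vector.\<close>

lemma pigeonhole_vector: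
  fixes h :: "'v \<Rightarrow> 'i \<Rightarrow> nat"
  assumes "finite V" "k ^ card V < card I"
    and h: "\<And>v i. v \<in> V \<Longrightarrow> i \<in> I \<Longrightarrow> h v i \<in> {1..k}"
  obtains i j where "i \<in> I" "j \<in> I" "i \<noteq> j" "\<And>v. v \<in> V \<Longrightarrow> h v i = h v j"
proof -
  let ?g = "\<lambda>i. \<lambda>v\<in>V. h v i"
  have "?g ` I \<subseteq> V \<rightarrow>\<^sub>E {1..k}"
    using h by auto
  then have "card (?g ` I) \<le> card (V \<rightarrow>\<^sub>E {1..k})"
    using assms(1) by (intro card_mono finite_PiE) auto
  also have "\<dots> = k ^ card V"
    using assms(1) by (simp add: card_PiE)
  finally have "\<not> inj_on ?g I"
    using assms(2) pigeonhole[of ?g I] by simp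
  then obtain i j where ij: "i \<in> I" "j \<in> I" "i \<noteq> j" "?g i = ?g j"
    by (auto simp: inj_on_def)
  then have "h v i = h v j" if "v \<in> V" for v
    using that by (metis restrict_apply')
  then show thesis
    using that ij by blast
qed

section \<open>Embedding the graph\<close>

text \<open>Copies are replaced by injections of \<open>V\<close>. Since an injection separates
  edges, a rainbow colouring of the image edges pulls back to the edges of \<open>E\<close>.\<close>

lemma local_rainbow_embedding:
  assumes "local_rainbow n V E k f" "E \<subseteq> complete_edges V" "inj_on \<phi> V" "\<phi> ` V \<subseteq> {..<n}"
  obtains v where "v \<in> V"
    "\<And>d e. d \<in> E \<Longrightarrow> e \<in> E \<Longrightarrow> f (\<phi> v) (\<phi> ` d) = f (\<phi> v) (\<phi> ` e) \<Longrightarrow> d = e"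
proof -
  have sub: "d \<subseteq> V" "card d = 2" if "d \<in> E" for d
    using that assms(2) by (auto simp: complete_edges_def)
  have "(\<lambda>d. \<phi> ` d) ` E \<subseteq> complete_edges (\<phi> ` V)"
    using sub assms(3) by (auto simp: complete_edges_def card_image inj_on_subset)
  then have "copy_in_complete n V E (\<phi> ` V) ((\<lambda>d. \<phi> ` d) ` E)"
    using assms(3,4) by (auto simp: copy_in_complete_def graph_isomorphic_def bij_betw_def)
  then obtain v where v: "v \<in> V" "inj_on (f (\<phi> v)) ((\<lambda>d. \<phi> ` d) ` E)"
    using assms(1) unfolding local_rainbow_def by blast
  show thesis
  proof (rule that[OF v(1)])
    fix d e assume "d \<in> E" "e \<in> E" "f (\<phi> v) (\<phi> ` d) = f (\<phi> v) (\<phi> ` e)"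
    then have "\<phi> ` d = \<phi> ` e"
      using v(2) by (auto dest: inj_onD)
    then show "d = e"
      using inj_on_image_eq_iff[OF assms(3)] sub \<open>d \<in> E\<close> \<open>e \<in> E\<close> by blast
  qed
qed

lemma local_rainbow_colour:
  assumes "local_rainbow n V E k f" "v < n" "a < n" "b < n" "a \<noteq> b"
  shows "f v {a, b} \<in> {1..k}"
proof -
  have "{a, b} \<in> complete_edges {..<n}"
    using assms by (auto simp: complete_edges_def)
  then show ?thesis
    using assms unfolding local_rainbow_def by blast
qed

text \<open>The vertices below \<open>card V\<close> hold the vertices of the graph that play no role in the
  coincidence; the next \<open>2 * k + 2\<close> vertices hold the \<open>k + 1\<close> candidates.\<close>

context
  fixes n k :: nat and V :: "'a set" and E :: "'a set set" and f m
  assumes rainbow: "local_rainbow n V E k f" and fin: "finite V" and E: "E \<subseteq> complete_edges V"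
  defines "m \<equiv> card V + 2 * k + 2"
begin

section \<open>First coincidence: shared by many vertices\<close>

text \<open>Disjoint \<open>d\<close> and \<open>e\<close> are placed on two of \<open>k + 1\<close>
  disjoint candidate edges. If they share a vertex \<open>s\<close>, it stays fixed and the
  candidates are \<open>k + 1\<close> edges through its position. The vertices from \<open>m\<close>
  on choose the popular pair.\<close>

lemma embed_edges_alike:
  assumes d: "d \<in> E" and e: "e \<in> E" and "d \<noteq> e" and "m < n"
  obtains \<psi> A where "inj_on \<psi> V" "\<psi> ` V \<subseteq> {..<m}" "A \<subseteq> {m..<n}"
    "n - m \<le> (k + 1)\<^sup>2 * card A" "\<And>a. a \<in> A \<Longrightarrow> f a (\<psi> ` d) = f a (\<psi> ` e)"
proof -
  obtain g where "bij_betw g V {..<card V}"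
    using ex_bij_betw_finite_nat[OF fin] by (auto simp: atLeast0LessThan)
  then have inj: "inj_on g V" and gV: "g ` V = {..<card V}"
    by (auto simp: bij_betw_def)
  have g: "g v < card V" if "v \<in> V" for v
    using that gV by blast
  show thesis
  proof (cases "d \<inter> e = {}")
    case True
    obtain p p' where p: "d = {p, p'}" "p \<noteq> p'" "p \<in> V" "p' \<in> V"
      using edge_doubleton[OF E d] .
    obtain q q' where q: "e = {q, q'}" "q \<noteq> q'" "q \<in> V" "q' \<in> V"
      using edge_doubleton[OF E e] .
    have neq: "p \<noteq> q" "p \<noteq> q'" "p' \<noteq> q" "p' \<noteq> q'"
      using True p q by auto
    \<comment> \<open>Steps of two keep the candidate edges disjoint; the last one ends at
      \<open>m - 1\<close>.\<close>
    define t where "t i = card V + 2 * i" for i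
    have "f a {t i, t i + 1} \<in> {1..k}" if "a \<in> {m..<n}" "i \<le> k" for a i
      using that \<open>m < n\<close> by (intro local_rainbow_colour[OF rainbow]) (auto simp: t_def m_def)
    then obtain i j where ij: "i < j" "j \<le> k" and
      le: "card {m..<n} \<le> (k + 1)\<^sup>2 * card {a \<in> {m..<n}. f a {t i, t i + 1} = f a {t j, t j + 1}}"
      by (rule popular_pair[of "{m..<n}" k "\<lambda>a i. f a {t i, t i + 1}", rotated 2]) (use \<open>m < n\<close> in auto)
    define \<psi> where "\<psi> = g(p := t i, p' := t i + 1, q := t j, q' := t j + 1)"
    have img: "\<psi> ` d = {t i, t i + 1}" "\<psi> ` e = {t j, t j + 1}"
      using p q neq by (auto simp: \<psi>_def)
    have "inj_on \<psi> V"
      \<comment> \<open>Unmoved vertices lie below \<open>card V\<close>, and the four new positions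
        are distinct because \<open>i < j\<close> gives \<open>t i + 1 < t j\<close>.\<close>
      unfolding \<psi>_def using inj ij
      by (intro inj_on_fun_updI) (auto simp: t_def split: if_splits dest: g, presburger)
    moreover have "\<psi> ` V \<subseteq> {..<m}"
      using g ij by (force simp: \<psi>_def t_def m_def)
    ultimately show thesis
      by (rule that[of \<psi> "{a \<in> {m..<n}. f a {t i, t i + 1} = f a {t j, t j + 1}}"]) (use le img in auto)
  next
    case False
    then obtain s where s: "s \<in> d" "s \<in> e" by auto
    obtain p where p: "d = {s, p}" "s \<noteq> p" "s \<in> V" "p \<in> V"
      using edge_other_end[OF E d s(1)] .
    obtain q where q: "e = {s, q}" "s \<noteq> q" "q \<in> V"
      using edge_other_end[OF E e s(2)] .
    have neq: "p \<noteq> q" using p q \<open>d \<noteq> e\<close> by auto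
    define t where "t i = card V + i" for i
    have "f a {g s, t i} \<in> {1..k}" if "a \<in> {m..<n}" "i \<le> k" for a i
      using that \<open>m < n\<close> g[OF \<open>s \<in> V\<close>]
      by (intro local_rainbow_colour[OF rainbow]) (auto simp: t_def m_def)
    then obtain i j where ij: "i < j" "j \<le> k" and
      le: "card {m..<n} \<le> (k + 1)\<^sup>2 * card {a \<in> {m..<n}. f a {g s, t i} = f a {g s, t j}}"
      by (rule popular_pair[of "{m..<n}" k "\<lambda>a i. f a {g s, t i}", rotated 2]) (use \<open>m < n\<close> in auto)
    define \<psi> where "\<psi> = g(p := t i, q := t j)"
    have img: "\<psi> ` d = {g s, t i}" "\<psi> ` e = {g s, t j}"
      using p q neq by (auto simp: \<psi>_def)
    have "inj_on \<psi> V"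
      unfolding \<psi>_def using inj ij
      by (intro inj_on_fun_updI) (auto simp: t_def split: if_splits dest: g)
    moreover have "\<psi> ` V \<subseteq> {..<m}"
      using g ij by (force simp: \<psi>_def t_def m_def)
    ultimately show thesis
      by (rule that[of \<psi> "{a \<in> {m..<n}. f a {g s, t i} = f a {g s, t j}}"]) (use le img in auto)
  qed
qed

text \<open>For the four-cycle the coinciding edges end at the observer \<open>a\<close> itself: any
  cycle vertex later placed in \<open>A\<close> sees its own two edges to \<open>x\<close> and
  \<open>y\<close> in one colour.\<close>

lemma embed_vertices_alike:
  assumes x: "x \<in> V" "y \<in> V" "x \<noteq> y" and "m < n"
  obtains \<psi> A where "inj_on \<psi> V" "\<psi> ` V \<subseteq> {..<m}" "A \<subseteq> {m..<n}"
    "n - m \<le> (k + 1)\<^sup>2 * card A" "\<And>a. a \<in> A \<Longrightarrow> f a {\<psi> x, a} = f a {\<psi> y, a}"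
proof -
  obtain g where "bij_betw g V {..<card V}"
    using ex_bij_betw_finite_nat[OF fin] by (auto simp: atLeast0LessThan)
  then have inj: "inj_on g V" and gV: "g ` V = {..<card V}"
    by (auto simp: bij_betw_def)
  have g: "g v < card V" if "v \<in> V" for v
    using that gV by blast
  define t where "t i = card V + i" for i
  have "f a {t i, a} \<in> {1..k}" if "a \<in> {m..<n}" "i \<le> k" for a i
    using that \<open>m < n\<close> by (intro local_rainbow_colour[OF rainbow]) (auto simp: t_def m_def)
  then obtain i j where ij: "i < j" "j \<le> k" and
    le: "card {m..<n} \<le> (k + 1)\<^sup>2 * card {a \<in> {m..<n}. f a {t i, a} = f a {t j, a}}"
    by (rule popular_pair[of "{m..<n}" k "\<lambda>a i. f a {t i, a}", rotated 2]) (use \<open>m < n\<close> in auto)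
  define \<psi> where "\<psi> = g(x := t i, y := t j)"
  have img: "\<psi> x = t i" "\<psi> y = t j"
    using x by (auto simp: \<psi>_def)
  have "inj_on \<psi> V"
    unfolding \<psi>_def using inj ij
    by (intro inj_on_fun_updI) (auto simp: t_def split: if_splits dest: g)
  moreover have "\<psi> ` V \<subseteq> {..<m}"
    using g ij by (force simp: \<psi>_def t_def m_def)
  ultimately show thesis
    by (rule that[of \<psi> "{a \<in> {m..<n}. f a {t i, a} = f a {t j, a}}"]) (use le img in auto)
qed

section \<open>Second coincidence: shared by all remaining vertices\<close>

lemma extend_by_cherry:
  assumes \<psi>: "\<psi> ` V \<subseteq> {..<m}" and A: "A \<subseteq> {m..<n}" "k ^ card V < card A" and x: "x \<in> V" and "m < n"
  obtains a b where "a \<in> A" "b \<in> A" "a \<noteq> b"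
    "\<And>v. v \<in> V \<Longrightarrow> f (\<psi> v) {\<psi> x, a} = f (\<psi> v) {\<psi> x, b}"
proof -
  have "f (\<psi> v) {\<psi> x, a} \<in> {1..k}" if "v \<in> V" "a \<in> A" for v a
  proof -
    have "\<psi> v < m" "\<psi> x < m" "a \<in> {m..<n}"
      using that \<psi> x A by auto
    then show ?thesis
      using \<open>m < n\<close> by (intro local_rainbow_colour[OF rainbow]) auto
  qed
  then show thesis
    using pigeonhole_vector[OF fin A(2), of "\<lambda>v a. f (\<psi> v) {\<psi> x, a}"] that by blast
qed

text \<open>An enumeration of \<open>A\<close> is cut into consecutive pairs. This gives
  \<open>k ^ card V + 1\<close> disjoint edges, one more than there are colour vectors, which
  explains the size required of \<open>A\<close>.\<close>

lemma extend_by_disjoint_edges: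
  assumes \<psi>: "\<psi> ` V \<subseteq> {..<m}" and A: "A \<subseteq> {m..<n}" "2 * (k ^ card V + 1) \<le> card A" and "m < n"
  obtains a a' b b' where "{a, a', b, b'} \<subseteq> A" "distinct [a, a', b, b']"
    "\<And>v. v \<in> V \<Longrightarrow> f (\<psi> v) {a, a'} = f (\<psi> v) {b, b'}"
proof -
  have "finite A" using A by (meson finite_atLeastLessThan finite_subset)
  then obtain h where h: "bij_betw h {..<card A} A"
    using ex_bij_betw_nat_finite by (metis atLeast0LessThan)
  let ?I = "{..<k ^ card V + 1}"
  have hA: "h (2 * i) \<in> A" "h (2 * i + 1) \<in> A" if "i \<in> ?I" for i
    using that A(2) bij_betwE[OF h] by auto
  have h_eq: "h i = h j \<longleftrightarrow> i = j" if "i < card A" "j < card A" for i j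
    using that h by (auto simp: bij_betw_def inj_on_def)
  have "f (\<psi> v) {h (2 * i), h (2 * i + 1)} \<in> {1..k}" if "v \<in> V" "i \<in> ?I" for v i
  proof -
    have "\<psi> v < m" "h (2 * i) \<in> {m..<n}" "h (2 * i + 1) \<in> {m..<n}"
      using that \<psi> A hA[of i] by auto
    moreover have "h (2 * i) \<noteq> h (2 * i + 1)"
      using that A(2) by (subst h_eq) auto
    ultimately show ?thesis
      using \<open>m < n\<close> by (intro local_rainbow_colour[OF rainbow]) auto
  qed
  then obtain i j where ij: "i \<in> ?I" "j \<in> ?I" "i \<noteq> j"
    "\<And>v. v \<in> V \<Longrightarrow> f (\<psi> v) {h (2 * i), h (2 * i + 1)} = f (\<psi> v) {h (2 * j), h (2 * j + 1)}"
    by (rule pigeonhole_vector[OF fin, of k ?I "\<lambda>v i. f (\<psi> v) {h (2 * i), h (2 * i + 1)}", rotated]) simp_all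
  have lt: "2 * i + 1 < card A" "2 * j + 1 < card A"
    using ij A(2) by auto
  show thesis
  proof (rule that)
    show "{h (2 * i), h (2 * i + 1), h (2 * j), h (2 * j + 1)} \<subseteq> A"
      using hA ij by blast
    show "distinct [h (2 * i), h (2 * i + 1), h (2 * j), h (2 * j + 1)]"
      using lt \<open>i \<noteq> j\<close> by (simp add: h_eq)
  qed (use ij in auto)
qed

section \<open>The two coincidences contradict each other's exceptions\<close>

text \<open>The summand \<open>m\<close> counts the reserved positions, the factor
  \<open>(k + 1)\<^sup>2\<close> is the loss to the popular pair, and the last factor is what the
  disjoint edges demand of \<open>A\<close>.\<close>

lemma local_rainbow_order_less:
  assumes card: "card E \<ge> 6"
  shows "n < m + (k + 1)\<^sup>2 * (2 * (k ^ card V + 1))"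
proof (rule ccontr)
  assume "\<not> ?thesis"
  then have n: "m + (k + 1)\<^sup>2 * (2 * (k ^ card V + 1)) \<le> n" by simp
  then have mn: "m < n"
    by (rule less_le_trans[rotated]) simp
  have large: "2 * (k ^ card V + 1) \<le> card A" if "n - m \<le> (k + 1)\<^sup>2 * card A" for A :: "nat set"
  proof -
    have "(k + 1)\<^sup>2 * (2 * (k ^ card V + 1)) \<le> (k + 1)\<^sup>2 * card A"
      using n that by linarith
    then show ?thesis by (simp only: mult_le_cancel1) simp
  qed
  have inV: "x \<in> V" if "x \<in> d" "d \<in> E" for x d
    using that E by (auto simp: complete_edges_def)
  have loop: "x \<noteq> y" if "{x, y} \<in> E" for x y
    using that E by (auto simp: complete_edges_def)
  have G: "finite_simple_graph V E"
    using fin E by (simp add: finite_simple_graph_def)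
  from G card show False
  proof (cases rule: graph_trichotomy)
    case (cherry x y z d e)
    obtain \<psi> A where \<psi>: "inj_on \<psi> V" "\<psi> ` V \<subseteq> {..<m}" and A: "A \<subseteq> {m..<n}"
      "n - m \<le> (k + 1)\<^sup>2 * card A" and de: "\<And>a. a \<in> A \<Longrightarrow> f a (\<psi> ` d) = f a (\<psi> ` e)"
      using embed_edges_alike[OF \<open>d \<in> E\<close> \<open>e \<in> E\<close> \<open>d \<noteq> e\<close> mn] by blast
    have V: "x \<in> V" "y \<in> V" "z \<in> V" "x \<noteq> y" "x \<noteq> z"
      using cherry(1,2) inV[of _ "{x, y}"] inV[of _ "{x, z}"] loop by auto
    obtain a b where ab: "a \<in> A" "b \<in> A" "a \<noteq> b"
      and eq: "\<And>v. v \<in> V \<Longrightarrow> f (\<psi> v) {\<psi> x, a} = f (\<psi> v) {\<psi> x, b}"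
      using extend_by_cherry[OF \<psi>(2) A(1) _ V(1) mn] large[OF A(2)] by auto
    \<comment> \<open>Only the leaves move into \<open>A\<close>, at or above \<open>m\<close>; all
      other vertices stay below \<open>m\<close>, so injectivity survives.\<close>
    define \<phi> where "\<phi> = \<psi>(y := a, z := b)"
    have range: "a \<in> {m..<n}" "b \<in> {m..<n}" using ab A by auto
    have lt: "\<psi> v < m" if "v \<in> V" for v using that \<psi> by auto
    have inj: "inj_on \<phi> V"
      unfolding \<phi>_def using \<psi>(1) range ab
      by (intro inj_on_fun_updI) (auto split: if_splits dest: lt)
    have "\<phi> ` V \<subseteq> {..<n}"
      using lt mn range by (force simp: \<phi>_def)
    then obtain v where v: "v \<in> V"
      "\<And>d e. d \<in> E \<Longrightarrow> e \<in> E \<Longrightarrow> f (\<phi> v) (\<phi> ` d) = f (\<phi> v) (\<phi> ` e) \<Longrightarrow> d = e"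
      using local_rainbow_embedding[OF rainbow E inj] by blast
    show False
    \<comment> \<open>A leaf sits in \<open>A\<close> and sees \<open>d\<close> and \<open>e\<close>
      alike; these avoid both leaves and have not moved. Any other vertex is still at
      \<open>\<psi> v\<close> and sees the two cherry edges alike.\<close>
    proof (cases "v = y \<or> v = z")
      case True
      then have "\<phi> v \<in> A" using ab by (auto simp: \<phi>_def)
      moreover have "\<phi> ` d = \<psi> ` d" "\<phi> ` e = \<psi> ` e"
        using cherry by (auto simp: \<phi>_def)
      ultimately have "d = e"
        using v(2)[of d e] de cherry by simp
      then show False using cherry by simp
    next
      case False
      moreover have "\<phi> ` {x, y} = {\<psi> x, a}" "\<phi> ` {x, z} = {\<psi> x, b}"
        using V cherry by (auto simp: \<phi>_def)
      ultimately have "{x, y} = {x, z}"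
        using v(2)[of "{x, y}" "{x, z}"] eq[OF v(1)] cherry by (simp add: \<phi>_def)
      then show False using cherry by (auto simp: doubleton_eq_iff)
    qed
  next
    case (matching d e p q)
    obtain y y' where y: "p = {y, y'}" "y \<noteq> y'" "y \<in> V" "y' \<in> V"
      using edge_doubleton[OF E \<open>p \<in> E\<close>] .
    obtain z z' where z: "q = {z, z'}" "z \<noteq> z'" "z \<in> V" "z' \<in> V"
      using edge_doubleton[OF E \<open>q \<in> E\<close>] .
    have neq: "y \<noteq> z" "y \<noteq> z'" "y' \<noteq> z" "y' \<noteq> z'"
      using matching y z by auto
    \<comment> \<open>Disjointness yields distinctness only for nonempty sets.\<close>
    have "d \<noteq> {}" using matching E by (auto simp: complete_edges_def)
    then have "d \<noteq> e" using matching by auto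
    obtain \<psi> A where \<psi>: "inj_on \<psi> V" "\<psi> ` V \<subseteq> {..<m}" and A: "A \<subseteq> {m..<n}"
      "n - m \<le> (k + 1)\<^sup>2 * card A" and de: "\<And>a. a \<in> A \<Longrightarrow> f a (\<psi> ` d) = f a (\<psi> ` e)"
      using embed_edges_alike[OF \<open>d \<in> E\<close> \<open>e \<in> E\<close> \<open>d \<noteq> e\<close> mn] by blast
    obtain a a' b b' where ab: "{a, a', b, b'} \<subseteq> A" "distinct [a, a', b, b']"
      and eq: "\<And>v. v \<in> V \<Longrightarrow> f (\<psi> v) {a, a'} = f (\<psi> v) {b, b'}"
      using extend_by_disjoint_edges[OF \<psi>(2) A(1) large[OF A(2)] mn] by blast
    define \<phi> where "\<phi> = \<psi>(y := a, y' := a', z := b, z' := b')"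
    have range: "a \<in> {m..<n}" "b \<in> {m..<n}" "a' \<in> {m..<n}" "b' \<in> {m..<n}" using ab A by auto
    have lt: "\<psi> v < m" if "v \<in> V" for v using that \<psi> by auto
    have inj: "inj_on \<phi> V"
      unfolding \<phi>_def using \<psi>(1) range ab
      by (intro inj_on_fun_updI) (auto split: if_splits dest: lt)
    have "\<phi> ` V \<subseteq> {..<n}"
      using lt mn range by (force simp: \<phi>_def)
    then obtain v where v: "v \<in> V"
      "\<And>d e. d \<in> E \<Longrightarrow> e \<in> E \<Longrightarrow> f (\<phi> v) (\<phi> ` d) = f (\<phi> v) (\<phi> ` e) \<Longrightarrow> d = e"
      using local_rainbow_embedding[OF rainbow E inj] by blast
    show False
    \<comment> \<open>The four ends of \<open>p\<close> and \<open>q\<close> are spoiled by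
      \<open>d\<close> and \<open>e\<close>, all other vertices by \<open>p\<close> and
      \<open>q\<close>.\<close>
    proof (cases "v \<in> p \<union> q")
      case True
      then have "\<phi> v \<in> A" using ab y z by (auto simp: \<phi>_def)
      moreover have "\<phi> ` d = \<psi> ` d" "\<phi> ` e = \<psi> ` e"
        unfolding \<phi>_def using matching y z by (auto intro!: image_cong)
      ultimately show False
        using v(2)[of d e] de matching \<open>d \<noteq> e\<close> by simp
    next
      case False
      moreover have "\<phi> ` p = {a, a'}" "\<phi> ` q = {b, b'}"
        using y z neq by (auto simp: \<phi>_def)
      ultimately have "p = q"
        using v(2)[of p q] eq[OF v(1)] matching y z by (simp add: \<phi>_def)
      then show False using matching y by auto
    qed
  next
    case (cycle x x' y z)
    have V: "x \<in> V" "x' \<in> V" "y \<in> V" "z \<in> V" "x \<noteq> y" "x \<noteq> z" "x' \<noteq> y" "x' \<noteq> z"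
      using cycle(1-4) inV[of _ "{x, y}"] inV[of _ "{x', z}"] loop by auto
    obtain \<psi> A where \<psi>: "inj_on \<psi> V" "\<psi> ` V \<subseteq> {..<m}" and A: "A \<subseteq> {m..<n}"
      "n - m \<le> (k + 1)\<^sup>2 * card A" and xx: "\<And>a. a \<in> A \<Longrightarrow> f a {\<psi> x, a} = f a {\<psi> x', a}"
      using embed_vertices_alike[OF V(1,2) \<open>x \<noteq> x'\<close> mn] by blast
    obtain a b where ab: "a \<in> A" "b \<in> A" "a \<noteq> b"
      and eq: "\<And>v. v \<in> V \<Longrightarrow> f (\<psi> v) {\<psi> x, a} = f (\<psi> v) {\<psi> x, b}"
      using extend_by_cherry[OF \<psi>(2) A(1) _ V(1) mn] large[OF A(2)] by auto
    define \<phi> where "\<phi> = \<psi>(y := a, z := b)"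
    have range: "a \<in> {m..<n}" "b \<in> {m..<n}" using ab A by auto
    have lt: "\<psi> v < m" if "v \<in> V" for v using that \<psi> by auto
    have inj: "inj_on \<phi> V"
      unfolding \<phi>_def using \<psi>(1) range ab
      by (intro inj_on_fun_updI) (auto split: if_splits dest: lt)
    have "\<phi> ` V \<subseteq> {..<n}"
      using lt mn range by (force simp: \<phi>_def)
    then obtain v where v: "v \<in> V"
      "\<And>d e. d \<in> E \<Longrightarrow> e \<in> E \<Longrightarrow> f (\<phi> v) (\<phi> ` d) = f (\<phi> v) (\<phi> ` e) \<Longrightarrow> d = e"
      using local_rainbow_embedding[OF rainbow E inj] by blast
    have img: "\<phi> ` {x, y} = {\<psi> x, a}" "\<phi> ` {x, z} = {\<psi> x, b}"
      "\<phi> ` {x', y} = {\<psi> x', a}" "\<phi> ` {x', z} = {\<psi> x', b}"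
      using V cycle by (auto simp: \<phi>_def)
    \<comment> \<open>The vertices \<open>y\<close> and \<open>z\<close> each see their own edges to
      \<open>x\<close> and \<open>x'\<close> alike; every other vertex sees the two edges at
      \<open>x\<close> alike.\<close>
    consider "v = y" | "v = z" | "v \<noteq> y" "v \<noteq> z" by blast
    then show False
    proof cases
      case 1
      then have "{x, y} = {x', y}"
        using v(2)[of "{x, y}" "{x', y}"] img xx[OF ab(1)] cycle by (simp add: \<phi>_def)
      then show False using cycle by (auto simp: doubleton_eq_iff)
    next
      case 2
      then have "{x, z} = {x', z}"
        using v(2)[of "{x, z}" "{x', z}"] img xx[OF ab(2)] cycle by (simp add: \<phi>_def)
      then show False using cycle by (auto simp: doubleton_eq_iff)
    next
      case 3
      then have "{x, y} = {x, z}"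
        using v(2)[of "{x, y}" "{x, z}"] img eq[OF v(1)] cycle by (simp add: \<phi>_def)
      then show False using cycle by (auto simp: doubleton_eq_iff)
    qed
  qed
qed

end

section \<open>From the bound to a power of n\<close>

lemma local_rainbow_order_le:
  assumes rainbow: "local_rainbow n V E k f" and G: "finite_simple_graph V E"
    and card: "card E \<ge> 6" and "n \<ge> 2"
  shows "n \<le> (card V + 20) * k ^ (card V + 2)"
proof -
  \<comment> \<open>As \<open>n \<ge> 2\<close>, there is an edge to colour, so \<open>k\<close> is
    positive and lower-order terms can be absorbed into \<open>k ^ (card V + 2)\<close>.\<close>
  have "f 0 {0, 1} \<in> {1..k}"
    using \<open>n \<ge> 2\<close> by (intro local_rainbow_colour[OF rainbow]) auto
  then have k: "k \<ge> 1" by auto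
  let ?r = "card V"
  have pw: "1 \<le> k ^ ?r" "k \<le> k ^ (?r + 2)" "1 \<le> k ^ (?r + 2)"
    using k self_le_power[of k "?r + 2"] by auto
  have "n \<le> ?r + 2 * k + 2 + (k + 1)\<^sup>2 * (2 * (k ^ ?r + 1))"
    using local_rainbow_order_less[OF rainbow _ _ card] G by (simp add: finite_simple_graph_def)
  \<comment> \<open>Here \<open>k + 1 \<le> 2 * k\<close> and \<open>1 \<le> k ^ ?r\<close>; the
    resulting 16 and the 4 from the reserved positions make up the constant 20.\<close>
  also have "(k + 1)\<^sup>2 * (2 * (k ^ ?r + 1)) \<le> (2 * k)\<^sup>2 * (2 * (k ^ ?r + k ^ ?r))"
    using k pw by (intro mult_mono power_mono) auto
  also have "\<dots> = 16 * k ^ (?r + 2)"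
    by (simp add: power_add power2_eq_square)
  also have "?r + 2 * k + 2 \<le> (?r + 4) * k ^ (?r + 2)"
  proof -
    have "?r * 1 \<le> ?r * k ^ (?r + 2)" using pw by (intro mult_le_mono2)
    then show ?thesis using pw by (simp only: add_mult_distrib)
  qed
  finally show ?thesis by (simp add: algebra_simps)
qed

theorem theorem7:
  fixes V :: "'a set" and E :: "'a set set"
  assumes "finite_simple_graph V E"
    and "card E \<ge> 6"
  shows "\<exists>b::real. b > 0 \<and>
    (\<lambda>n. real (local_rainbow_number n V E)) \<in> \<Omega>[at_top](\<lambda>n. real n powr b)"
proof (intro exI conjI)
  \<comment> \<open>Solving \<open>n \<le> C * k ^ s\<close> for \<open>k\<close> gives the exponent
    \<open>1 / s\<close> and the constant \<open>C powr (- b)\<close>.\<close>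
  define s where "s = card V + 2"
  define C where "C = real (card V + 20)"
  define b where "b = 1 / real s"
  have C: "C > 0" and s: "s > 0" by (auto simp: C_def s_def)
  show b: "b > 0" by (simp add: b_def s_def)
  have "E \<noteq> {}" using assms(2) by auto
  then have V: "V \<noteq> {}"
    using assms(1) by (auto simp: finite_simple_graph_def complete_edges_def)
  show "(\<lambda>n. real (local_rainbow_number n V E)) \<in> \<Omega>[at_top](\<lambda>n. real n powr b)"
  proof (rule landau_omega.bigI[of "C powr (- b)"])
    show "C powr (- b) > 0" using C by simp
    show "\<forall>\<^sub>F n in at_top. C powr (- b) * norm (real n powr b) \<le> norm (real (local_rainbow_number n V E))"
      using eventually_ge_at_top[of 2]
    proof eventually_elim
      fix n :: nat assume n: "n \<ge> 2"
      define k where "k = local_rainbow_number n V E"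
      obtain f where "local_rainbow n V E k f"
        using local_rainbow_number_attained[OF V] unfolding k_def by blast
      then have "n \<le> (card V + 20) * k ^ s"
        unfolding s_def by (rule local_rainbow_order_le[OF _ assms n])
      then have "real n \<le> C * real k ^ s"
        unfolding C_def by (metis of_nat_le_iff of_nat_mult of_nat_power)
      then have "real n powr b \<le> (C * real k ^ s) powr b"
        using b by (intro powr_mono2) auto
      also have "\<dots> = C powr b * real k"
      \<comment> \<open>The rule \<open>powr_realpow\<close> requires a positive base; for
        \<open>k = 0\<close> both sides are 0 because \<open>s > 0\<close>.\<close>
      proof (cases "k = 0")
        case False
        then have "(real k ^ s) powr b = real k"
          using s by (simp add: powr_realpow[symmetric] powr_powr b_def)
        then show ?thesis using C by (simp add: powr_mult)
      qed (use s in simp)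
      finally show "C powr (- b) * norm (real n powr b) \<le> norm (real (local_rainbow_number n V E))"
        using C by (simp add: k_def powr_minus field_simps)
    qed
  qed
qed

end
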